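(* Let $\pi$ be a probability measure on $\mathbb{N}_0$ with mean $E>0$, and let $\omega,\xi$ be probability distributions on $\mathbb{R}$ such that: (i) $\xi$ is lower bounded, and is either continuous (no atoms) or has its only atom at its minimum $m_\xi\in\mathbb{R}$; (ii) $\omega$ is continuous (no atoms), and its support is locally convex under its maximum $M_\omega\in\mathbb{R}\cup\{+\infty\}$; (iii) $\pi$ has a finite second moment. Let $h_X$ be the cumulative distribution function of $\xi$ and let $\hat\phi$ be the probability generating function of $\hat\pi$. Then for any pair $(h_+,h_-)$ of cumulative distribution functions with $h_+\le h_-$ that verify, for all $t\in\mathbb{R}$, $$h_+(t)=h_X(t)\,\hat\phi\Big(1-\mathbb{E}_{W\sim\omega}[h_-(W-t)]\Big),\qquad h_-(t)=h_X(t)\,\hat\phi\Big(1-\mathbb{E}_{W\sim\omega}[h_+(W-t)]\Big),$$ we have $h_-=h_+$.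
   Context: $\mathbb{N}_0=\{0,1,2,\dots\}$, $\hat\pi(k)=\frac{(k+1)\pi(k+1)}{E}$ for $k\in\mathbb{N}_0$, and $\hat\phi(s)=\sum_{k\ge0}\hat\pi(k)s^k$ for $s\in[0,1]$. Cumulative distribution functions are those of probability distributions on $\mathbb{R}$, $h(t)=\mathbb{P}(Y\le t)$. "The support of $\omega$ is locally convex under its maximum $M_\omega$" ($M_\omega$ being the supremum of the support) means that the support contains a non-empty open interval with right endpoint $M_\omega$: $(M_\omega-\varepsilon,M_\omega)$ for some $\varepsilon>0$ if $M_\omega<\infty$, or $(A,+\infty)$ for some $A\in\mathbb{R}$ if $M_\omega=+\infty$. *)

theory Defs
  imports "HOL-Probability.Probability"
begin

definition measure_support :: "'a::topological_space measure \<Rightarrow> 'a set" where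
  "measure_support M = {x. \<forall>U. open U \<longrightarrow> x \<in> U \<longrightarrow> 0 < emeasure M U}"

definition atoms :: "'a measure \<Rightarrow> 'a set" where
  "atoms M = {x. 0 < emeasure M {x}}"

text \<open>The minimum of a distribution on the line that is bounded below: since the support is
  closed and nonempty, the infimum is attained.\<close>

definition dist_min :: "real measure \<Rightarrow> real" where
  "dist_min M = Inf (measure_support M)"

definition dist_max :: "real measure \<Rightarrow> ereal" where
  "dist_max M = (SUP x\<in>measure_support M. ereal x)"

text \<open>The support contains a nonempty open interval whose right endpoint is the (possibly
  infinite) maximum of the distribution.\<close>

definition locally_convex_under_max :: "real measure \<Rightarrow> bool" where
  "locally_convex_under_max M \<longleftrightarrow>
    (\<exists>a::real. ereal a < dist_max M \<and>
      {x. a < x \<and> ereal x < dist_max M} \<subseteq> measure_support M)"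

definition is_cdf :: "(real \<Rightarrow> real) \<Rightarrow> bool" where
  "is_cdf h \<longleftrightarrow> (\<exists>M. real_distribution M \<and> h = cdf M)"

definition pmf_mean :: "nat pmf \<Rightarrow> real" where
  "pmf_mean p = measure_pmf.expectation p real"

definition pi_hat :: "nat pmf \<Rightarrow> nat \<Rightarrow> real" where
  "pi_hat p k = real (k + 1) * pmf p (k + 1) / pmf_mean p"

text \<open>For a pmf with finite positive mean, the series converges on the unit interval, which is
  where it is used.\<close>

definition phi_hat :: "nat pmf \<Rightarrow> real \<Rightarrow> real" where
  "phi_hat p s = (\<Sum>k. pi_hat p k * s ^ k)"

end

theory Submission
  imports Defs
begin

text \<open>Let \<open>Z\<^sub>+\<close>, \<open>Z\<^sub>-\<close> and \<open>W\<close> be independent with laws \<open>h\<^sub>+\<close>, \<open>h\<^sub>-\<close> and \<open>\<omega>\<close>, and let \<open>G\<^sub>\<plusminus>\<close> be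
  the continuous distribution function of \<open>W - Z\<^sub>\<plusminus>\<close>, so that \<open>h\<^sub>+ = h\<^sub>X \<cdot> \<phi>(G\<^sub>-)\<close>,
  \<open>h\<^sub>- = h\<^sub>X \<cdot> \<phi>(G\<^sub>+)\<close> and \<open>G\<^sub>- \<le> G\<^sub>+\<close>. In the matching interpretation an edge is used when
  \<open>Z\<^sub>+ + Z\<^sub>- \<le> W\<close>. Computing the probability of this event from either endpoint gives
  \<open>\<integral> (\<integral>\<^bsub>G\<^sub>-(x)\<^esub>\<^bsup>1\<^esup> \<phi>(u) du) \<xi>(dx) = \<integral> (\<integral>\<^bsub>G\<^sub>+(x)\<^esub>\<^bsup>1\<^esup> \<phi>(u) du) \<xi>(dx)\<close>, and since
  \<open>G\<^sub>- \<le> G\<^sub>+\<close> and \<open>\<phi> > 0\<close> on \<open>(0, 1]\<close> this forces \<open>G\<^sub>- = G\<^sub>+\<close> on the support of \<open>\<xi>\<close>, in particular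
  at its minimum. Equality of \<open>G\<^sub>\<plusminus>\<close> at \<open>t\<close> gives equality of \<open>h\<^sub>\<plusminus>\<close> at \<open>w - t\<close> for all \<open>w\<close> in the
  top interval of the support of \<open>\<omega>\<close>, and \<open>\<phi>\<close> is injective unless it is constant, so equality
  spreads from the minimum of \<open>\<xi>\<close> to the whole line.\<close>

section \<open>Supports on the line and equality at support points\<close>

text \<open>The complement is the union of all open null sets; by Lindelof, countably many of them
  already cover it.\<close>

lemma emeasure_Compl_measure_support:
  fixes M :: "'a::second_countable_topology measure"
  assumes [simp]: "sets M = sets borel"
  shows "emeasure M (- measure_support M) = 0"
proof -
  define F where "F = {U::'a set. open U \<and> emeasure M U = 0}"
  have "\<Union>F = - measure_support M"
    by (auto simp: F_def measure_support_def zero_less_iff_neq_zero)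
  moreover obtain F' where F': "F' \<subseteq> F" "countable F'" "\<Union>F' = \<Union>F"
    using Lindelof[of F] by (auto simp: F_def)
  moreover have "(\<Union>U\<in>F'. U) \<in> null_sets M"
    using F' by (intro null_sets_UN') (auto simp: F_def null_sets_def)
  ultimately show ?thesis by (auto simp: null_sets_def)
qed

lemma closed_measure_support: "closed (measure_support M)"
proof -
  have "- measure_support M = \<Union>{U. open U \<and> emeasure M U = 0}"
    by (auto simp: measure_support_def zero_less_iff_neq_zero)
  then show ?thesis by (auto simp: closed_def)
qed

lemma real_distribution_AE_measure_support:
  assumes "real_distribution M"
  shows "AE x in M. x \<in> measure_support M"
proof -
  interpret real_distribution M by fact
  have "- measure_support M \<in> sets M"
    using closed_measure_support[of M] by (auto simp: closed_def)
  then show ?thesis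
    using emeasure_Compl_measure_support[of M]
    by (intro AE_I[of _ _ "- measure_support M"]) auto
qed

lemma dist_min_in_measure_support:
  assumes "real_distribution M" and bdd: "bdd_below (measure_support M)"
  shows "dist_min M \<in> measure_support M"
proof -
  interpret real_distribution M by fact
  have "measure_support M \<noteq> {}"
  proof
    assume "measure_support M = {}"
    then have "AE x in M. False" 
      using real_distribution_AE_measure_support[OF assms(1)] by simp
    then show False by simp
  qed
  then show ?thesis
    unfolding dist_min_def using bdd closed_measure_support by (intro closed_contains_Inf) auto
qed

lemma cdf_eq_0_below_dist_min:
  assumes "real_distribution M" and bdd: "bdd_below (measure_support M)" and t: "t < dist_min M"
  shows "cdf M t = 0"
proof -
  interpret real_distribution M by fact
  have "AE x in M. x \<notin> {..t}"
    using real_distribution_AE_measure_support[OF assms(1)]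
  proof eventually_elim
    case (elim x)
    then have "dist_min M \<le> x" unfolding dist_min_def using bdd by (intro cInf_lower)
    then show ?case using t by auto
  qed
  then show ?thesis unfolding cdf_def by (subst prob_eq_0) auto
qed

lemma cdf_pos_above_dist_min:
  assumes "real_distribution M" and bdd: "bdd_below (measure_support M)" and t: "dist_min M < t"
  shows "cdf M t > 0"
proof -
  interpret real_distribution M by fact
  have "0 < emeasure M {..<t}"
    using dist_min_in_measure_support[OF assms(1,2)] t by (auto simp: measure_support_def)
  also have "\<dots> \<le> emeasure M {..t}" by (intro emeasure_mono) auto
  finally show ?thesis by (simp add: cdf_def emeasure_eq_measure)
qed

text \<open>The set where two continuous functions differ is open, so if it is null it contains no
  support point.\<close>

lemma AE_eq_on_measure_support:
  fixes f g :: "real \<Rightarrow> real"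
  assumes "real_distribution M" and "AE x in M. f x = g x" and "x \<in> measure_support M"
    and f: "continuous_on UNIV f" and g: "continuous_on UNIV g"
  shows "f x = g x"
proof (rule ccontr)
  interpret real_distribution M by fact
  assume "f x \<noteq> g x"
  moreover have op: "open {x. f x \<noteq> g x}" using f g by (rule open_Collect_neq)
  ultimately have "0 < emeasure M {x. f x \<noteq> g x}"
    using assms(3) by (auto simp: measure_support_def)
  moreover have "emeasure M {x. f x \<noteq> g x} = 0"
    using assms(2) op by (subst (asm) AE_iff_measurable[of "{x. f x \<noteq> g x}"]) auto
  ultimately show False by simp
qed

text \<open>Right continuity spreads a disagreement at \<open>x\<close> only to an interval on its
  right, which need not contain \<open>x\<close>. A whole neighbourhood inside the support makes
  that interval non-null.\<close>

lemma AE_eq_right_continuous_measure_support: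
  fixes f g :: "real \<Rightarrow> real"
  assumes "real_distribution M" and AE: "AE x in M. f x = g x"
    and f: "continuous (at_right x) f" and g: "continuous (at_right x) g"
    and U: "open U" "x \<in> U" "U \<subseteq> measure_support M"
  shows "f x = g x"
proof (rule ccontr)
  interpret real_distribution M by fact
  assume "f x \<noteq> g x"
  moreover have "((\<lambda>y. f y - g y) \<longlongrightarrow> f x - g x) (at_right x)"
    using f g by (auto simp: continuous_within intro: tendsto_diff)
  ultimately have "eventually (\<lambda>y. f y - g y \<noteq> 0) (at_right x)"
    by (intro tendsto_imp_eventually_ne) auto
  moreover have "eventually (\<lambda>y. y \<in> U) (at_right x)"
    using U by (meson eventually_at_topological)
  ultimately have "eventually (\<lambda>y. f y \<noteq> g y \<and> y \<in> U) (at_right x)"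
    by eventually_elim auto
  then obtain b where b: "b > x" "\<And>y. x < y \<Longrightarrow> y < b \<Longrightarrow> f y \<noteq> g y \<and> y \<in> U"
    by (auto simp: eventually_at_right_field)
  obtain y where y: "x < y" "y < b" using b(1) dense by blast
  then have "y \<in> measure_support M" using b(2) U by auto
  then have "0 < emeasure M {x<..<b}" using y by (auto simp: measure_support_def)
  moreover have "AE y in M. y \<notin> {x<..<b}"
    using AE by eventually_elim (use b in auto)
  then have "emeasure M {x<..<b} = 0" by (subst (asm) AE_iff_measurable[of "{x<..<b}"]) auto
  ultimately show False by simp
qed

section \<open>Laws of differences of independent variables\<close>

lemma measurable_cdf:
  assumes "real_distribution M"
  shows "cdf M \<in> borel_measurable borel"
proof -
  interpret real_distribution M by fact
  show ?thesis by (intro borel_measurable_mono monoI cdf_nondecreasing)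
qed

definition diff_law :: "real measure \<Rightarrow> real measure \<Rightarrow> real measure" where
  "diff_law M N = distr (M \<Otimes>\<^sub>M N) borel (\<lambda>(x, y). x - y)"

context
  fixes M N :: "real measure"
  assumes M: "real_distribution M" and N: "real_distribution N"
begin

interpretation M: real_distribution M by (fact M)
interpretation N: real_distribution N by (fact N)
interpretation pair_prob_space M N ..

lemma real_distribution_diff_law: "real_distribution (diff_law M N)"
  unfolding diff_law_def by (rule P.real_distribution_distr) simp

text \<open>For fixed \<open>y\<close> the section of the line \<open>x - y = t\<close> is the
  single point \<open>t + y\<close>, which is null for \<open>M\<close>.\<close>

lemma diff_law_no_atoms:
  assumes "atoms M = {}"
  shows "measure (diff_law M N) {t} = 0"
proof -
  have "emeasure (diff_law M N) {t} = emeasure (M \<Otimes>\<^sub>M N) {p \<in> space (M \<Otimes>\<^sub>M N). fst p - snd p = t}"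
    unfolding diff_law_def
    by (subst emeasure_distr) (auto intro!: arg_cong2[where f=emeasure] simp: space_pair_measure)
  also have "\<dots> = (\<integral>\<^sup>+y. emeasure M ((\<lambda>x. (x, y)) -` {p \<in> space (M \<Otimes>\<^sub>M N). fst p - snd p = t}) \<partial>N)"
    by (rule emeasure_pair_measure_alt2) measurable
  also have "\<dots> = (\<integral>\<^sup>+y. emeasure M {t + y} \<partial>N)"
    by (intro nn_integral_cong arg_cong2[where f=emeasure]) (auto simp: space_pair_measure)
  also have "\<dots> = 0" using assms by (simp add: atoms_def)
  finally show ?thesis by (simp add: measure_def)
qed

text \<open>By Fubini the left side is the probability of \<open>{t..}\<close> under
  \<open>diff_law M N\<close>; absence of atoms allows \<open>{t..}\<close> to be replaced by the
  complement of \<open>{..t}\<close>.\<close>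

lemma integral_cdf_eq_diff_law:
  assumes "atoms M = {}"
  shows "(LINT x|M. cdf N (x - t)) = 1 - cdf (diff_law M N) t"
proof -
  note [measurable] = measurable_cdf[OF N]
  interpret D: real_distribution "diff_law M N" by (rule real_distribution_diff_law)
  have "emeasure (diff_law M N) {t..} = emeasure (M \<Otimes>\<^sub>M N) {p \<in> space (M \<Otimes>\<^sub>M N). t \<le> fst p - snd p}"
    unfolding diff_law_def
    by (subst emeasure_distr) (auto intro!: arg_cong2[where f=emeasure] simp: space_pair_measure)
  also have "\<dots> = (\<integral>\<^sup>+x. emeasure N (Pair x -` {p \<in> space (M \<Otimes>\<^sub>M N). t \<le> fst p - snd p}) \<partial>M)"
    by (rule N.emeasure_pair_measure_alt) measurable
  also have "\<dots> = (\<integral>\<^sup>+x. ennreal (cdf N (x - t)) \<partial>M)"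
    by (intro nn_integral_cong)
       (auto simp: space_pair_measure cdf_def N.emeasure_eq_measure 
          intro!: arg_cong2[where f=measure])
  also have "\<dots> = ennreal (LINT x|M. cdf N (x - t))"
    by (intro nn_integral_eq_integral M.integrable_const_bound[where B=1])
       (auto simp: N.cdf_nonneg N.cdf_bounded_prob)
  finally have "measure (diff_law M N) {t..} = (LINT x|M. cdf N (x - t))"
    by (simp add: measure_def N.cdf_nonneg)
  moreover have "measure (diff_law M N) ({t} \<union> {t<..}) = 
      measure (diff_law M N) {t} + measure (diff_law M N) {t<..}"
    by (intro D.finite_measure_Union) auto
  moreover have "{t} \<union> {t<..} = {t..}" "UNIV - {..t} = {t<..}" by auto
  ultimately show ?thesis
    using diff_law_no_atoms[OF assms, of t] D.prob_compl[of "{..t}"]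
    by (simp add: cdf_def)
qed

lemma integral_diff_law:
  fixes f :: "real \<Rightarrow> real"
  assumes [measurable]: "f \<in> borel_measurable borel" and f: "\<And>x. \<bar>f x\<bar> \<le> B"
  shows "(LINT t|diff_law M N. f t) = (LINT x|M. LINT y|N. f (x - y))"
proof -
  have "(LINT t|diff_law M N. f t) = (LINT p|(M \<Otimes>\<^sub>M N). (\<lambda>(x, y). f (x - y)) p)"
    unfolding diff_law_def by (subst integral_distr) (auto simp: split_beta')
  also have "\<dots> = (LINT x|M. LINT y|N. f (x - y))"
    by (subst integral_fst'[symmetric])
       (auto intro!: P.integrable_const_bound[where B=B] simp: f)
  finally show ?thesis .
qed

end

text \<open>Both sides are the cdf at \<open>w\<close> of the convolution of \<open>M\<close> and
  \<open>N\<close>, which is commutative.\<close>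

lemma integral_cdf_diff_commute:
  assumes M: "real_distribution M" and N: "real_distribution N"
  shows "(LINT x|M. cdf N (w - x)) = (LINT x|N. cdf M (w - x))"
proof -
  have *: "(LINT x|A. cdf B (w - x)) = measure (A \<star> B) {..w}"
    if A: "real_distribution A" and B: "real_distribution B" for A B
  proof -
    interpret A: real_distribution A by fact
    interpret B: real_distribution B by fact
    have [measurable]: "cdf B \<in> borel_measurable borel"
      by (rule measurable_cdf[OF B])
    have "emeasure (A \<star> B) {..w} = (\<integral>\<^sup>+x. emeasure B {a. a + x \<in> {..w}} \<partial>A)"
      by (rule convolution_emeasure)
         (auto simp: A.finite_measure_axioms B.finite_measure_axioms)
    also have "\<dots> = (\<integral>\<^sup>+x. ennreal (cdf B (w - x)) \<partial>A)"
      by (intro nn_integral_cong)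
        (auto simp: cdf_def B.emeasure_eq_measure intro!: arg_cong2[where f=measure])
    also have "\<dots> = ennreal (LINT x|A. cdf B (w - x))"
      by (intro nn_integral_eq_integral A.integrable_const_bound[where B=1])
         (auto simp: B.cdf_nonneg B.cdf_bounded_prob)
    finally show ?thesis by (simp add: measure_def B.cdf_nonneg)
  qed
  interpret M: real_distribution M by fact
  interpret N: real_distribution N by fact
  have "(M \<star> N) = (N \<star> M)"
    by (rule convolution_commutative) (auto simp: M.finite_measure_axioms N.finite_measure_axioms)
  then show ?thesis by (simp add: * M N)
qed

section \<open>The uniform law and the probability integral transform\<close>

definition unif :: "real measure" where
  "unif = uniform_measure lborel {0..1}"

text \<open>For \<open>0 < u < 1\<close>, continuity makes \<open>{t. cdf M t \<le> u}\<close> a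
  closed half-line whose endpoint is mapped exactly to \<open>u\<close>, so its probability is
  \<open>u\<close>.\<close>

lemma distr_cdf_uniform:
  assumes "real_distribution M" and no_atoms: "\<And>t. measure M {t} = 0"
  shows "distr M borel (cdf M) = unif"
  unfolding unif_def
proof (rule cdf_unique)
  interpret real_distribution M by fact
  have [measurable]: "cdf M \<in> borel_measurable borel"
    by (rule measurable_cdf[OF assms(1)])
  have cont: "isCont (cdf M) x" for x by (simp add: isCont_cdf no_atoms)
  show D: "real_distribution (distr M borel (cdf M))" by (rule real_distribution_distr) simp
  interpret U: prob_space "uniform_measure lborel {0..1::real}"
    by (rule prob_space_uniform_measure) auto
  show "real_distribution (uniform_measure lborel {0..1})" by standard auto
  interpret D: real_distribution "distr M borel (cdf M)" by (rule D)
  have in01: "cdf (distr M borel (cdf M)) u = u" if u: "0 < u" "u < 1" for u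
  proof -
    define S where "S = {t. cdf M t \<le> u}"
    have "\<forall>\<^sub>F t in at_top. u < cdf M t" using order_tendstoD(1)[OF cdf_lim_at_top_prob] u by simp
    then obtain b where b: "\<And>t. t \<ge> b \<Longrightarrow> u < cdf M t" by (auto simp: eventually_at_top_linorder)
    have "\<forall>\<^sub>F t in at_bot. cdf M t < u" using order_tendstoD(2)[OF cdf_lim_at_bot] u by simp
    then obtain a where a: "\<And>t. t \<le> a \<Longrightarrow> cdf M t < u" by (auto simp: eventually_at_bot_linorder)
    have "closed S" unfolding S_def
      by (intro closed_Collect_le continuous_intros continuous_at_imp_continuous_on ballI cont)
    moreover have bdd: "bdd_above S"
      by (rule bdd_aboveI[of _ b]) (metis S_def b mem_Collect_eq linear not_le)
    moreover have "S \<noteq> {}" using a[of a] by (auto simp: S_def intro: less_imp_le)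
    ultimately have Sup: "Sup S \<in> S" by (intro closed_contains_Sup)
    have S: "S = {..Sup S}"
    proof (intro set_eqI iffI)
      fix t assume "t \<in> {..Sup S}"
      then show "t \<in> S" using Sup cdf_nondecreasing[of t "Sup S"] by (auto simp: S_def)
    qed (use bdd in \<open>auto intro: cSup_upper\<close>)
    have "a \<le> b" using a[of a] b[of a] by force
    then obtain s where "cdf M s = u"
      using IVT'[of "cdf M" a u b] a[of a] b[of b] cont
      by (force intro: continuous_at_imp_continuous_on)
    then have "u \<le> cdf M (Sup S)" 
      using cdf_nondecreasing[of s "Sup S"] bdd by (auto simp: S_def intro!: cSup_upper)
    then have "cdf M (Sup S) = u" using Sup by (auto simp: S_def)
    moreover have "cdf (distr M borel (cdf M)) u = measure M S"
      unfolding cdf_def[of "distr M borel (cdf M)"] S_def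
      by (subst measure_distr) (auto intro!: arg_cong2[where f=measure])
    ultimately show ?thesis using S by (simp add: cdf_def)
  qed
  show "cdf (distr M borel (cdf M)) = cdf (uniform_measure lborel {0..1})"
  proof
    fix u :: real
    have eqU: "cdf (uniform_measure lborel {0..1}) u = measure lborel ({0..1} \<inter> {..u})"
      by (simp add: cdf_def)
    consider "u < 0" | "u = 0" | "0 < u" "u < 1" | "u \<ge> 1" by linarith
    then show "cdf (distr M borel (cdf M)) u = cdf (uniform_measure lborel {0..1}) u"
    proof cases
      case 1
      then have "\<not> cdf M x \<le> u" for x using cdf_nonneg[of x] by linarith
      then have "cdf M -` {..u} = {}" by auto
      then show ?thesis using 1 by (simp add: eqU cdf_def[of "distr _ _ _"] measure_distr)
    next
      case 2
      have "cdf (distr M borel (cdf M)) 0 \<le> e" if "0 < e" for e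
      proof (cases "e < 1")
        case True
        then show ?thesis using D.cdf_nondecreasing[of 0 e] in01[of e] that by simp
      qed (use D.cdf_bounded_prob[of 0] in linarith)
      then have "cdf (distr M borel (cdf M)) 0 \<le> 0" by (rule field_le_epsilon) simp
      moreover have "{0..1} \<inter> {..0} = {0::real}" by auto
      ultimately show ?thesis using 2 eqU D.cdf_nonneg[of 0] by simp
    next
      case 3
      then have "{0..1} \<inter> {..u} = {0..u}" by auto
      then show ?thesis using 3 in01 by (simp add: eqU)
    next
      case 4
      then have "cdf M -` {..u} = UNIV" using cdf_bounded_prob by (auto intro: order_trans)
      moreover have "{0..1} \<inter> {..u} = {0..1}" using 4 by auto
      ultimately show ?thesis using prob_space
        by (simp add: eqU cdf_def[of "distr _ _ _"] measure_distr)
    qed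
  qed
qed

section \<open>Positivity and monotonicity of the generating function\<close>

context
  fixes p :: "nat pmf"
  assumes mean_pos: "pmf_mean p > 0"
begin

lemma pi_hat_nonneg: "0 \<le> pi_hat p k"
  using mean_pos by (simp add: pi_hat_def)

lemma summable_pi_hat: "summable (pi_hat p)"
proof -
  \<comment> \<open>A non-integrable function has integral \<open>0\<close> by convention, so a
    positive mean already yields integrability.\<close>
  have "integrable (measure_pmf p) real"
    using mean_pos not_integrable_integral_eq[of "measure_pmf p" real] by (auto simp: pmf_mean_def)
  then have "integrable (count_space UNIV) (\<lambda>k. pmf p k * real k)"
    by (simp add: measure_pmf_eq_density integrable_density)
  then have "summable (\<lambda>k. real k * pmf p k)"
    by (simp add: integrable_count_space_nat_iff mult.commute)
  then have "summable (\<lambda>k. real (Suc k) * pmf p (Suc k))"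
    by (subst summable_Suc_iff)
  then show ?thesis
    unfolding pi_hat_def by (simp add: summable_divide)
qed

text \<open>Otherwise \<open>p\<close> is concentrated at \<open>0\<close> and has mean
  \<open>0\<close>.\<close>

lemma pi_hat_pos_ex: "\<exists>k. 0 < pi_hat p k"
proof (rule ccontr)
  assume "\<not> ?thesis"
  then have "pmf p (Suc k) = 0" for k
    using pi_hat_nonneg[of k] mean_pos by (simp add: pi_hat_def order_less_le)
  then have "a \<in> set_pmf p \<Longrightarrow> real a \<noteq> 0 \<Longrightarrow> a \<in> {}" for a
    by (cases a) (auto simp: set_pmf_iff)
  then have "pmf_mean p = 0"
    unfolding pmf_mean_def by (subst integral_measure_pmf_real[of "{}"]) auto
  then show False using mean_pos by simp
qed

lemma summable_phi_hat: "0 \<le> s \<Longrightarrow> s \<le> 1 \<Longrightarrow> summable (\<lambda>k. pi_hat p k * s ^ k)"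
  using summable_pi_hat
  by (rule summable_comparison_test'[where N=0])
     (auto simp: pi_hat_nonneg power_le_one abs_mult intro!: mult_left_le)

lemma phi_hat_mono: "0 \<le> s \<Longrightarrow> s \<le> t \<Longrightarrow> t \<le> 1 \<Longrightarrow> phi_hat p s \<le> phi_hat p t"
  unfolding phi_hat_def
  by (intro suminf_le summable_phi_hat mult_left_mono power_mono pi_hat_nonneg) auto

lemma phi_hat_nonneg: "0 \<le> s \<Longrightarrow> s \<le> 1 \<Longrightarrow> 0 \<le> phi_hat p s"
  unfolding phi_hat_def by (intro suminf_nonneg summable_phi_hat) (auto simp: pi_hat_nonneg)

lemma phi_hat_pos:
  assumes "0 < s" "s \<le> 1"
  shows "0 < phi_hat p s"
proof -
  obtain k where "0 < pi_hat p k" using pi_hat_pos_ex by blast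
  then show ?thesis
    unfolding phi_hat_def using assms
    by (intro suminf_pos2[of _ k] summable_phi_hat) (auto simp: pi_hat_nonneg)
qed

text \<open>The term of index \<open>k\<close> grows strictly and no other term decreases. This
  supplies the injectivity needed to pass from equal cdfs to equal smoothings.\<close>

lemma phi_hat_strict_mono:
  assumes k: "0 < k" "pi_hat p k \<noteq> 0" and st: "0 \<le> s" "s < t" "t \<le> 1"
  shows "phi_hat p s < phi_hat p t"
proof -
  have "0 < (\<Sum>j. pi_hat p j * t ^ j - pi_hat p j * s ^ j)"
  proof (rule suminf_pos2[of _ k])
    show "summable (\<lambda>j. pi_hat p j * t ^ j - pi_hat p j * s ^ j)"
      using st by (intro summable_diff summable_phi_hat) auto
    show "0 \<le> pi_hat p j * t ^ j - pi_hat p j * s ^ j" for j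
      using st pi_hat_nonneg[of j] by (simp add: mult_left_mono power_mono)
    have "s ^ k < t ^ k" using k st by (intro power_strict_mono) auto
    then show "0 < pi_hat p k * t ^ k - pi_hat p k * s ^ k"
      using k pi_hat_nonneg[of k] by simp
  qed
  also have "\<dots> = phi_hat p t - phi_hat p s"
    unfolding phi_hat_def using st by (intro suminf_diff[symmetric] summable_phi_hat) auto
  finally show ?thesis by simp
qed

text \<open>The degenerate case, \<open>p\<close> carried by \<open>{0, 1}\<close>, in which
  injectivity fails. It covers \<open>s = 0\<close> too, since \<open>0 ^ 0 = 1\<close>.\<close>

lemma phi_hat_const:
  assumes "\<And>k. 0 < k \<Longrightarrow> pi_hat p k = 0"
  shows "phi_hat p s = pi_hat p 0"
  unfolding phi_hat_def using assms by (subst suminf_finite[of "{0}"]) auto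

end

section \<open>Upper tail integrals against the uniform law\<close>

lemma measurable_phi_hat [measurable]: "phi_hat p \<in> borel_measurable borel"
  unfolding phi_hat_def by measurable

lemma AE_unif_iff: "(AE u in unif. P u) \<longleftrightarrow> (AE u in lborel. 0 \<le> u \<and> u \<le> 1 \<longrightarrow> P u)"
  unfolding unif_def by (subst AE_uniform_measure) auto

lemma unif_prob_space: "prob_space unif"
  unfolding unif_def by (rule prob_space_uniform_measure) auto

lemma sets_unif [simp, measurable_cong]: "sets unif = sets borel"
  by (simp add: unif_def)

text \<open>The bound on \<open>f\<close> is asked for only on the unit interval, which carries
  \<open>unif\<close>; outside it the series behind \<open>phi_hat\<close> may diverge.\<close>

lemma upper_tail_integral:
  fixes f :: "real \<Rightarrow> real"
  assumes [measurable]: "f \<in> borel_measurable borel" and f: "\<And>u. 0 \<le> u \<Longrightarrow> u \<le> 1 \<Longrightarrow> \<bar>f u\<bar> \<le> B"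
  shows "integrable unif (\<lambda>u. f u * indicator {v..} u)" 
    and "\<bar>LINT u|unif. f u * indicator {v..} u\<bar> \<le> B"
proof -
  interpret prob_space unif by (rule unif_prob_space)
  have AE: "AE u in unif. \<bar>f u * indicator {v..} u\<bar> \<le> B"
    unfolding AE_unif_iff using f order_trans[OF abs_ge_zero f[of 0]]
    by (intro AE_I2) (auto simp: indicator_def)
  show int: "integrable unif (\<lambda>u. f u * indicator {v..} u)"
    using AE by (intro integrable_const_bound[where B=B]) auto
  have "\<bar>LINT u|unif. f u * indicator {v..} u\<bar> \<le> (LINT u|unif. \<bar>f u * indicator {v..} u\<bar>)"
    by (rule integral_abs_bound)
  also have "\<dots> \<le> (LINT u|unif. B)"
    using AE int by (intro integral_mono_AE) auto
  finally show "\<bar>LINT u|unif. f u * indicator {v..} u\<bar> \<le> B" by (simp add: prob_space)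
qed

text \<open>If \<open>v < v'\<close>, equal integrals would make \<open>f\<close> vanish almost
  everywhere on \<open>{v<..<v'}\<close>, an interval of positive length on which \<open>f\<close>
  is positive.\<close>

lemma upper_tail_integral_inj:
  fixes f :: "real \<Rightarrow> real"
  assumes [measurable]: "f \<in> borel_measurable borel" and f: "\<And>u. 0 \<le> u \<Longrightarrow> u \<le> 1 \<Longrightarrow> \<bar>f u\<bar> \<le> B"
    and nonneg: "\<And>u. 0 \<le> u \<Longrightarrow> u \<le> 1 \<Longrightarrow> 0 \<le> f u" and pos: "\<And>u. 0 < u \<Longrightarrow> u < 1 \<Longrightarrow> 0 < f u"
    and v: "0 \<le> v" "v \<le> v'" "v' \<le> 1"
    and eq: "(LINT u|unif. f u * indicator {v..} u) = (LINT u|unif. f u * indicator {v'..} u)"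
  shows "v = v'"
proof (rule ccontr)
  assume "v \<noteq> v'"
  have "AE u in unif. f u * indicator {v'..} u = f u * indicator {v..} u"
    using v nonneg upper_tail_integral(1)[OF assms(1) f] eq
    by (intro integral_ineq_eq_0_then_AE) (auto simp: AE_unif_iff indicator_def intro!: AE_I2)
  then have "AE u in lborel. u \<notin> {v<..<v'}"
    unfolding AE_unif_iff
  proof eventually_elim
    case (elim u)
    then show ?case using pos[of u] v by (auto simp: indicator_def split: if_splits)
  qed
  then have "emeasure lborel {v<..<v'} = 0"
    by (subst (asm) AE_iff_measurable[of "{v<..<v'}"]) auto
  then show False using v \<open>v \<noteq> v'\<close> by (simp add: emeasure_lborel_Ioo)
qed

text \<open>Write \<open>cdf X t\<close> as the probability of \<open>x \<le> t\<close>, exchange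
  the integrals, and substitute \<open>u = cdf N t\<close>.\<close>

lemma integral_cdf_mult_transform:
  fixes f :: "real \<Rightarrow> real"
  assumes X: "real_distribution X" and N: "real_distribution N" 
    and unif: "distr N borel (cdf N) = unif"
    and [measurable]: "f \<in> borel_measurable borel" and f: "\<And>u. 0 \<le> u \<Longrightarrow> u \<le> 1 \<Longrightarrow> \<bar>f u\<bar> \<le> B"
  shows "(LINT t|N. cdf X t * f (cdf N t)) = (LINT x|X. LINT u|unif. f u * indicator {cdf N x..} u)"
proof -
  interpret X: real_distribution X by fact
  interpret N: real_distribution N by fact
  interpret pair_prob_space X N ..
  have [measurable]: "cdf N \<in> borel_measurable borel"
    by (rule measurable_cdf[OF N])
  have f': "\<bar>f (cdf N t)\<bar> \<le> B" for t
    using f N.cdf_nonneg N.cdf_bounded_prob by blast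
  have B: "0 \<le> B" using f'[of 0] by linarith
  have "(LINT t|N. cdf X t * f (cdf N t)) = (LINT t|N. LINT x|X. (if x \<le> t then f (cdf N t) else 0))"
  proof (intro Bochner_Integration.integral_cong refl)
    fix t
    have "(LINT x|X. (if x \<le> t then f (cdf N t) else 0)) = (LINT x|X. f (cdf N t) * indicator {..t} x)"
      by (intro Bochner_Integration.integral_cong) (auto simp: indicator_def)
    then show "cdf X t * f (cdf N t) = (LINT x|X. (if x \<le> t then f (cdf N t) else 0))"
      by (simp add: cdf_def)
  qed
  also have "\<dots> = (LINT x|X. LINT t|N. (if x \<le> t then f (cdf N t) else 0))"
    by (intro Fubini_integral P.integrable_const_bound[where B=B])
       (auto simp: f' B)
  also have "\<dots> = (LINT x|X. LINT u|unif. f u * indicator {cdf N x..} u)"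
  proof (rule Bochner_Integration.integral_cong[OF refl])
    fix x
    have "(LINT u|unif. f u * indicator {cdf N x..} u) = 
        (LINT t|N. f (cdf N t) * indicator {cdf N x..} (cdf N t))"
      unfolding unif[symmetric] by (subst integral_distr) auto
    \<comment> \<open>\<open>cdf N\<close> may be flat in places, so \<open>x \<le> t\<close> and
      \<open>cdf N x \<le> cdf N t\<close> are equivalent only off the level set of
      \<open>cdf N x\<close>, which is null because the image law is uniform.\<close>
    moreover have "AE t in N. cdf N t \<noteq> cdf N x"
    proof -
      have "AE u in lborel. u \<noteq> cdf N x" by (rule AE_lborel_singleton)
      then have "AE u in unif. u \<noteq> cdf N x" unfolding AE_unif_iff by eventually_elim simp
      then show ?thesis unfolding unif[symmetric] by (subst (asm) AE_distr_iff) auto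
    qed
    then have "AE t in N. (if x \<le> t then f (cdf N t) else 0) = 
        f (cdf N t) * indicator {cdf N x..} (cdf N t)"
    proof eventually_elim
      case (elim t)
      then show ?case
        using N.cdf_nondecreasing[of t x] N.cdf_nondecreasing[of x t] by (auto simp: indicator_def)
    qed
    then have "(LINT t|N. (if x \<le> t then f (cdf N t) else 0)) = 
        (LINT t|N. f (cdf N t) * indicator {cdf N x..} (cdf N t))"
      by (intro integral_cong_AE) auto
    ultimately show "(LINT t|N. (if x \<le> t then f (cdf N t) else 0)) = 
        (LINT u|unif. f u * indicator {cdf N x..} u)" by simp
  qed
  finally show ?thesis .
qed

section \<open>Propagation of equality by reflection\<close>

text \<open>Below, \<open>D\<close> stands for the set where the two distribution functions agree and \<open>S\<close> for the
  set where their smoothings by \<open>\<omega>\<close> agree. Reflecting twice extends \<open>D\<close> downwards by the fixed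
  length \<open>M - a\<close>, so finitely many steps exhaust the half-line above \<open>m\<close>.\<close>

lemma reflected_interval_propagation:
  fixes D S :: "real set" and m a :: real and M :: ereal
  assumes aM: "ereal a < M" and m: "m \<in> S"
    and SD: "\<And>t w. t \<in> S \<Longrightarrow> a < w \<Longrightarrow> ereal w < M \<Longrightarrow> w - t \<in> D"
    and DS: "\<And>t. t \<in> D \<Longrightarrow> m < t \<Longrightarrow> t \<in> S"
    and below: "\<And>t. t < m \<Longrightarrow> t \<in> D"
    and above: "\<And>t. M < ereal (t + m) \<Longrightarrow> t \<in> D"
    and right: "\<And>t r. t < r \<Longrightarrow> {t<..<r} \<subseteq> D \<Longrightarrow> t \<in> D"
  shows "D = UNIV"
proof (cases M)
  case PInf
  have "x \<in> D" for x
  proof -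
    \<comment> \<open>Large enough that \<open>t > m\<close> and that both \<open>t + m\<close> and
      \<open>x + t\<close> exceed \<open>a\<close>; an infinite \<open>M\<close> imposes no upper
      constraint.\<close>
    define t where "t = max m (max (a - m) (a - x)) + 1"
    have "(t + m) - m \<in> D" using m PInf by (intro SD) (auto simp: t_def)
    then have "t \<in> S" by (intro DS) (auto simp: t_def)
    then have "(x + t) - t \<in> D" using PInf by (intro SD) (auto simp: t_def)
    then show ?thesis by simp
  qed
  then show ?thesis by auto
next
  case MInf
  then show ?thesis using aM by simp
next
  case (real c)
  define e where "e = c - a"
  have e: "0 < e" using aM real by (simp add: e_def)
  \<comment> \<open>The inequality in \<open>above\<close> is strict, so the endpoint
    \<open>c - m\<close> comes from \<open>right\<close>.\<close>
  have ge: "t \<in> D" if "c - m \<le> t" for t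
  proof (rule right[of _ "t + 1"])
    show "{t<..<t + 1} \<subseteq> D" using above real that by auto
  qed simp
  have step: "{b - e<..} \<subseteq> D" if b: "{b<..} \<subseteq> D" "m \<le> b" "b < c - m" for b
  proof
    fix s assume s: "s \<in> {b - e<..}"
    \<comment> \<open>First reflection: \<open>{b<..}\<close> lies in \<open>S\<close>, and
      \<open>t\<close> is the midpoint of the nonempty interval from \<open>max b (a - r)\<close> to
      \<open>c - r\<close>.\<close>
    have low: "r \<in> D" if r: "r < c - b" for r
    proof -
      define t where "t = (max b (a - r) + (c - r)) / 2"
      have t: "b < t" "a < r + t" "r + t < c" using r e by (auto simp: t_def e_def max_def field_simps)
      then have "t \<in> S" using b by (intro DS) auto
      then have "(r + t) - t \<in> D" using t real by (intro SD) auto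
      then show ?thesis by simp
    qed
    show "s \<in> D"
    proof (cases "c - m \<le> s")
      case False
      \<comment> \<open>Second reflection, from the points between \<open>m\<close> and
        \<open>c - b\<close> just obtained. The interval for \<open>t\<close> is nonempty because
        \<open>b - e < s < c - m\<close> and \<open>b < c - m\<close>.\<close>
      define t where "t = (max m (a - s) + min (c - b) (c - s)) / 2"
      have t: "m < t" "t < c - b" "a < s + t" "s + t < c"
        using s e b False by (auto simp: t_def e_def max_def min_def field_simps)
      then have "t \<in> S" using low by (intro DS) auto
      then have "(s + t) - t \<in> D" using t real by (intro SD) auto
      then show ?thesis by simp
    qed (rule ge)
  qed
  \<comment> \<open>Reflecting the single point \<open>m\<close> starts the induction at
    \<open>a - m\<close>. The maximum with \<open>m\<close> appears because only points of
    \<open>D\<close> above \<open>m\<close> are returned to \<open>S\<close>.\<close>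
  have "{max m (a - m - real n * e)<..} \<subseteq> D" for n
  proof (induction n)
    case 0
    show ?case
    proof
      fix r assume r: "r \<in> {max m (a - m - real 0 * e)<..}"
      have "(r + m) - m \<in> D" if "r < c - m" using r real m that by (intro SD) auto
      then show "r \<in> D" using ge[of r] by (cases "r < c - m") auto
    qed
  next
    case (Suc n)
    let ?b = "a - m - real n * e"
    have eq: "a - m - real (Suc n) * e = ?b - e" by (simp add: algebra_simps)
    show ?case
    proof (cases "m \<le> ?b")
      case True
      moreover have "0 \<le> real n * e" using e by simp
      then have "?b < c - m" using e unfolding e_def by linarith
      ultimately have "{?b - e<..} \<subseteq> D" using Suc by (intro step) (auto simp: max_def)
      then show ?thesis unfolding eq by auto
    next
      case False
      then show ?thesis using Suc e unfolding eq by (auto simp: max_def)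
    qed
  qed
  \<comment> \<open>Chosen so that \<open>a - m - real n * e < m\<close>.\<close>
  moreover obtain n where "a - 2 * m < real n * e"
    using reals_Archimedean3[OF e] by blast
  ultimately have "{m<..} \<subseteq> D" by (smt (verit) max_def)
  moreover from this have "m \<in> D" by (intro right[of m "m + 1"]) auto
  ultimately show ?thesis using below by (metis UNIV_eq_I greaterThan_iff linorder_neqE subsetD)
qed

section \<open>The edge identity and its consequence for the smoothed cdfs\<close>

text \<open>With the variable of law \<open>\<omega>\<close> integrated last, the claim reduces, for
  each of its values \<open>w\<close>, to commutativity of the convolution of \<open>M\<close> and
  \<open>N\<close>.\<close>

lemma integral_cdf_diff_law_symmetric:
  assumes O: "real_distribution \<omega>" and M: "real_distribution M" and N: "real_distribution N"
  shows "(LINT t|diff_law \<omega> M. cdf N t) = (LINT t|diff_law \<omega> N. cdf M t)"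
proof -
  have *: "(LINT t|diff_law \<omega> A. cdf B t) = (LINT w|\<omega>. LINT z|A. cdf B (w - z))"
    if A: "real_distribution A" and B: "real_distribution B" for A B
  proof -
    interpret B: real_distribution B by fact
    show ?thesis
      by (intro integral_diff_law[where B=1] O A measurable_cdf[OF B])
         (simp add: B.cdf_nonneg B.cdf_bounded_prob)
  qed
  show ?thesis by (simp add: * M N integral_cdf_diff_commute[OF M N])
qed

text \<open>Both sides of the symmetric identity equal the probability that \<open>W - Z - Z'\<close> is nonnegative for
  independent \<open>Z\<close>, \<open>Z'\<close> with laws \<open>M\<close>, \<open>N\<close>; the recursion and the uniform law of
  \<open>cdf D\<close> under \<open>D\<close> turn each into an integral against \<open>\<xi>\<close> of a monotone function of one cdf.\<close>

lemma coupled_recursion_AE_eq: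
  fixes f :: "real \<Rightarrow> real"
  assumes X: "real_distribution \<xi>" and O: "real_distribution \<omega>" and no_atoms: "atoms \<omega> = {}"
    and M: "real_distribution M" and N: "real_distribution N"
    and f_meas: "f \<in> borel_measurable borel" and f: "\<And>u. 0 \<le> u \<Longrightarrow> u \<le> 1 \<Longrightarrow> \<bar>f u\<bar> \<le> B"
    and nonneg: "\<And>u. 0 \<le> u \<Longrightarrow> u \<le> 1 \<Longrightarrow> 0 \<le> f u" and pos: "\<And>u. 0 < u \<Longrightarrow> u < 1 \<Longrightarrow> 0 < f u"
    and cdf_M: "\<And>t. cdf M t = cdf \<xi> t * f (cdf (diff_law \<omega> N) t)"
    and cdf_N: "\<And>t. cdf N t = cdf \<xi> t * f (cdf (diff_law \<omega> M) t)"
    and le: "\<And>t. cdf (diff_law \<omega> N) t \<le> cdf (diff_law \<omega> M) t"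
  shows "AE x in \<xi>. cdf (diff_law \<omega> N) x = cdf (diff_law \<omega> M) x"
proof -
  interpret X: real_distribution \<xi> by fact
  interpret unif: prob_space unif by (rule unif_prob_space)
  note [measurable] = f_meas
  define H where "H v = (LINT u|unif. f u * indicator {v..} u)" for v
  have H_meas [measurable]: "H \<in> borel_measurable borel"
  proof -
    have "H = (\<lambda>v. LINT u|unif. (if v \<le> u then f u else 0))"
      unfolding H_def by (intro ext Bochner_Integration.integral_cong) (auto simp: indicator_def)
    then show ?thesis by simp
  qed
  have *: "(LINT t|diff_law \<omega> A. cdf A' t) = (LINT x|\<xi>. H (cdf (diff_law \<omega> A) x)) \<and>
      integrable \<xi> (\<lambda>x. H (cdf (diff_law \<omega> A) x)) \<and> (\<forall>x. 0 \<le> cdf (diff_law \<omega> A) x \<and> cdf (diff_law \<omega> A) x \<le> 1)"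
    if A: "real_distribution A" and eq: "\<And>t. cdf A' t = cdf \<xi> t * f (cdf (diff_law \<omega> A) t)" for A A'
  proof -
    have D: "real_distribution (diff_law \<omega> A)" by (rule real_distribution_diff_law[OF O A])
    interpret D: real_distribution "diff_law \<omega> A" by (rule D)
    have [measurable]: "cdf (diff_law \<omega> A) \<in> borel_measurable borel" by (rule measurable_cdf[OF D])
    have "distr (diff_law \<omega> A) borel (cdf (diff_law \<omega> A)) = unif"
      by (rule distr_cdf_uniform[OF D diff_law_no_atoms[OF O A no_atoms]])
    from integral_cdf_mult_transform[OF X D this f_meas f]
    have "(LINT t|diff_law \<omega> A. cdf A' t) = (LINT x|\<xi>. H (cdf (diff_law \<omega> A) x))"
      unfolding H_def by (simp add: eq)
    moreover have "\<bar>H v\<bar> \<le> B" for v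
      using upper_tail_integral(2)[OF f_meas f] by (simp add: H_def)
    then have "integrable \<xi> (\<lambda>x. H (cdf (diff_law \<omega> A) x))"
      by (intro X.integrable_const_bound[where B=B]) auto
    ultimately show ?thesis using D.cdf_nonneg D.cdf_bounded_prob by auto
  qed
  \<comment> \<open>The recursion pairs \<open>cdf N\<close> with \<open>diff_law \<omega> M\<close>
    and \<open>cdf M\<close> with \<open>diff_law \<omega> N\<close>, exactly as on the two sides of
    the symmetric identity.\<close>
  note HM = *[OF M cdf_N] and HN = *[OF N cdf_M]
  from HM HN have bounds: "0 \<le> cdf (diff_law \<omega> N) x" "cdf (diff_law \<omega> M) x \<le> 1" for x by blast+
  \<comment> \<open>\<open>H\<close> is antitone, so \<open>le\<close> orders the two integrands; as
    their integrals coincide, they agree almost everywhere.\<close>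
  have "AE x in \<xi>. H (cdf (diff_law \<omega> M) x) = H (cdf (diff_law \<omega> N) x)"
  proof (rule integral_ineq_eq_0_then_AE)
    show "AE x in \<xi>. H (cdf (diff_law \<omega> M) x) \<le> H (cdf (diff_law \<omega> N) x)"
    proof (rule AE_I2)
      fix x
      show "H (cdf (diff_law \<omega> M) x) \<le> H (cdf (diff_law \<omega> N) x)"
        unfolding H_def using le[of x] nonneg
        by (intro integral_mono_AE upper_tail_integral(1)[OF f_meas f])
           (auto simp: AE_unif_iff indicator_def intro!: AE_I2)
    qed
    show "(LINT x|\<xi>. H (cdf (diff_law \<omega> M) x)) = (LINT x|\<xi>. H (cdf (diff_law \<omega> N) x))"
      using HM HN integral_cdf_diff_law_symmetric[OF O M N] by simp
  qed (use HM HN in auto)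
  then show ?thesis
  proof eventually_elim
    case (elim x)
    show ?case
      by (rule upper_tail_integral_inj[OF f_meas f nonneg pos _ le _ elim[symmetric, unfolded H_def]])
         (use bounds in blast)+
  qed
qed

section \<open>Uniqueness of the solution pair\<close>

lemma continuous_at_right_shift:
  fixes h :: "real \<Rightarrow> real"
  assumes "continuous (at_right (w - t)) h"
  shows "continuous (at_right w) (\<lambda>w. h (w - t))"
  using assms unfolding continuous_within
  unfolding at_right_to_0[of w] at_right_to_0[of "w - t"]
  by (simp add: filterlim_filtermap algebra_simps)

theorem proposition4p2:
  fixes p :: "nat pmf" and \<omega> \<xi> :: "real measure" and hp hm :: "real \<Rightarrow> real"
  assumes mean_pos: "pmf_mean p > 0"
    and omega: "real_distribution \<omega>"
    and xi: "real_distribution \<xi>"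
    and xi_bounded_below: "bdd_below (measure_support \<xi>)"
    and xi_atoms: "atoms \<xi> = {} \<or> atoms \<xi> = {dist_min \<xi>}"
    and omega_continuous: "atoms \<omega> = {}"
    and omega_support: "locally_convex_under_max \<omega>"
    and second_moment: "integrable (measure_pmf p) (\<lambda>k. (real k)\<^sup>2)"
    and cdf_plus: "is_cdf hp"
    and cdf_minus: "is_cdf hm"
    and le: "\<And>t. hp t \<le> hm t"
    and eq_plus: "\<And>t. hp t = cdf \<xi> t * phi_hat p (1 - (LINT w|\<omega>. hm (w - t)))"
    and eq_minus: "\<And>t. hm t = cdf \<xi> t * phi_hat p (1 - (LINT w|\<omega>. hp (w - t)))"
  shows "hm = hp"
proof (cases "\<forall>k>0. pi_hat p k = 0")
  \<comment> \<open>Here \<open>phi_hat p\<close> is constant, and the two equations have the same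
    right-hand side.\<close>
  case True
  then have "phi_hat p s = pi_hat p 0" for s by (intro phi_hat_const mean_pos) auto
  then have "hm t = hp t" for t unfolding eq_plus[of t] eq_minus[of t] by simp
  then show ?thesis by auto
next
  case False
  then obtain k where k: "0 < k" "pi_hat p k \<noteq> 0" by blast
  interpret omega: real_distribution \<omega> by fact
  obtain P N where P: "real_distribution P" "hp = cdf P" and N: "real_distribution N" "hm = cdf N"
    using cdf_plus cdf_minus by (auto simp: is_cdf_def)
  interpret P: real_distribution P by (rule P)
  interpret N: real_distribution N by (rule N)
  define GP GN where "GP = cdf (diff_law \<omega> P)" and "GN = cdf (diff_law \<omega> N)"
  interpret DP: real_distribution "diff_law \<omega> P" by (rule real_distribution_diff_law[OF omega P(1)])
  interpret DN: real_distribution "diff_law \<omega> N" by (rule real_distribution_diff_law[OF omega N(1)])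
  have GP: "(LINT w|\<omega>. hp (w - t)) = 1 - GP t" for t
    unfolding P GP_def by (rule integral_cdf_eq_diff_law[OF omega P(1) omega_continuous])
  have GN: "(LINT w|\<omega>. hm (w - t)) = 1 - GN t" for t
    unfolding N GN_def by (rule integral_cdf_eq_diff_law[OF omega N(1) omega_continuous])
  have [measurable]: "hp \<in> borel_measurable borel" "hm \<in> borel_measurable borel"
    unfolding P N by (intro measurable_cdf P N)+
  have hp01: "0 \<le> hp t" "hp t \<le> 1" and hm01: "0 \<le> hm t" "hm t \<le> 1" for t
    by (simp_all add: P N P.cdf_nonneg P.cdf_bounded_prob N.cdf_nonneg N.cdf_bounded_prob)
  have int: "integrable \<omega> (\<lambda>w. hp (w - t))" "integrable \<omega> (\<lambda>w. hm (w - t))" for t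
    by (rule omega.integrable_const_bound[where B=1], simp add: hp01 hm01, measurable)+
  have le_G: "GN t \<le> GP t" for t
    using integral_mono[OF int, of t t] le unfolding GP GN by simp
  have G01: "0 \<le> GP t" "GP t \<le> 1" "0 \<le> GN t" "GN t \<le> 1" for t
    by (simp_all add: GP_def GN_def DP.cdf_nonneg DP.cdf_bounded_prob DN.cdf_nonneg DN.cdf_bounded_prob)
  have cont: "continuous_on UNIV GP" "continuous_on UNIV GN"
    by (auto simp: GP_def GN_def DP.isCont_cdf DN.isCont_cdf diff_law_no_atoms omega P N omega_continuous
        intro!: continuous_at_imp_continuous_on)
  have right_cont: "continuous (at_right t) hp" "continuous (at_right t) hm" for t
    by (auto simp: P N P.cdf_is_right_cont N.cdf_is_right_cont)
  have eq_P: "hp t = cdf \<xi> t * phi_hat p (GN t)" and eq_N: "hm t = cdf \<xi> t * phi_hat p (GP t)" for t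
    using eq_plus[of t] eq_minus[of t] by (simp_all add: GP GN)
  define m where "m = dist_min \<xi>"
  have m0: "cdf \<xi> t = 0" if "t < m" for t
    using cdf_eq_0_below_dist_min[OF xi xi_bounded_below] that by (simp add: m_def)
  have mpos: "0 < cdf \<xi> t" if "m < t" for t
    using cdf_pos_above_dist_min[OF xi xi_bounded_below] that by (simp add: m_def)
  have "AE x in \<xi>. GN x = GP x"
    unfolding GP_def GN_def
  proof (rule coupled_recursion_AE_eq[OF xi omega omega_continuous P(1) N(1) measurable_phi_hat])
    show "\<bar>phi_hat p u\<bar> \<le> phi_hat p 1" if "0 \<le> u" "u \<le> 1" for u
      using phi_hat_nonneg[OF mean_pos that] phi_hat_mono[OF mean_pos that(1,2)] by simp
    show "0 < phi_hat p u" if "0 < u" "u < 1" for u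
      using phi_hat_pos[OF mean_pos that(1)] that(2) by simp
  qed (fact phi_hat_nonneg[OF mean_pos] eq_P[unfolded P GN_def] eq_N[unfolded N GP_def]
      le_G[unfolded GN_def GP_def])+
  then have Gm: "GN m = GP m"
    unfolding m_def
    by (rule AE_eq_on_measure_support[OF xi _ dist_min_in_measure_support[OF xi xi_bounded_below] cont(2,1)])
  have AE_eq: "AE w in \<omega>. hp (w - t) = hm (w - t)" if "GN t = GP t" for t
    using int le that by (intro integral_ineq_eq_0_then_AE) (auto simp: GP GN)
  obtain a where a: "ereal a < dist_max \<omega>" 
      "{x. a < x \<and> ereal x < dist_max \<omega>} \<subseteq> measure_support \<omega>"
    using omega_support by (auto simp: locally_convex_under_max_def)
  have "{t. hp t = hm t} = UNIV"
  proof (rule reflected_interval_propagation[OF a(1), of m "{t. GN t = GP t}"])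
    \<comment> \<open>Equal smoothings of ordered functions give equality only for almost every
      \<open>w\<close>; right continuity upgrades it to every \<open>w\<close> in the top interval,
      which is open and lies in the support.\<close>
    fix t w assume t: "t \<in> {t. GN t = GP t}" and w: "a < w" "ereal w < dist_max \<omega>"
    have "open {x. a < x \<and> ereal x < dist_max \<omega>}"
      by (intro open_Collect_conj open_Collect_less continuous_intros)
    moreover have "AE w in \<omega>. hp (w - t) = hm (w - t)" using t by (intro AE_eq) simp
    ultimately have "hp (w - t) = hm (w - t)"
      using w a(2)
      by (intro AE_eq_right_continuous_measure_support[OF omega _ continuous_at_right_shift[OF right_cont(1)]
            continuous_at_right_shift[OF right_cont(2)]]) simp_all
    then show "w - t \<in> {t. hp t = hm t}" by simp
  next
    \<comment> \<open>Above \<open>m\<close> the factor \<open>cdf \<xi> t\<close> is positive and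
      cancels, leaving the injectivity of \<open>phi_hat p\<close>.\<close>
    fix t assume t: "t \<in> {t. hp t = hm t}" "m < t"
    then have "phi_hat p (GN t) = phi_hat p (GP t)" using mpos[of t] by (simp add: eq_P eq_N)
    then have "\<not> GN t < GP t"
      using phi_hat_strict_mono[OF mean_pos k, of "GN t" "GP t"] G01 by auto
    then show "t \<in> {t. GN t = GP t}" using le_G[of t] by auto
  next
    \<comment> \<open>Almost every \<open>w\<close> satisfies \<open>w - t < m\<close>, where both
      cdfs vanish. The two smoothings at \<open>t\<close> then coincide, and the recursion gives
      equality at \<open>t\<close>.\<close>
    fix t assume t: "dist_max \<omega> < ereal (t + m)"
    have "AE w in \<omega>. hp (w - t) = hm (w - t)"
      using real_distribution_AE_measure_support[OF omega]
    proof eventually_elim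
      case (elim w)
      then have "ereal w \<le> dist_max \<omega>" unfolding dist_max_def by (rule SUP_upper)
      then have "ereal w < ereal (t + m)" using t by (rule le_less_trans)
      then show ?case by (simp add: eq_P eq_N m0)
    qed
    then have "(LINT w|\<omega>. hp (w - t)) = (LINT w|\<omega>. hm (w - t))"
      by (intro integral_cong_AE) auto
    then show "t \<in> {t. hp t = hm t}" using eq_plus[of t] eq_minus[of t] by simp
  next
    fix t r :: real assume "t < r" and sub: "{t<..<r} \<subseteq> {t. hp t = hm t}"
    then have "eventually (\<lambda>s. hp s = hm s) (at_right t)"
      unfolding eventually_at_right_field by (intro exI[of _ r]) auto
    then have "(hm \<longlongrightarrow> hp t) (at_right t)"
      using right_cont(1)[of t] unfolding continuous_within by (rule Lim_transform_eventually[rotated])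
    then have "hp t = hm t"
      using right_cont(2)[of t] unfolding continuous_within
      by (intro tendsto_unique[of "at_right t"]) auto
    then show "t \<in> {t. hp t = hm t}" by simp
  next
    fix t assume "t < m"
    then show "t \<in> {t. hp t = hm t}" unfolding mem_Collect_eq eq_P eq_N by (simp add: m0)
  qed (use Gm in simp)
  then have "hp t = hm t" for t by blast
  then show ?thesis by (intro ext) simp
qed

end
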